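(* Let $A\in\mathbb{R}^{m\times n}$, $I\subseteq[m]\times[r]$, $J\subseteq[n]\times[r]$ be such that the infimum of $L(X,Y)=\|A-XY^\top\|_F^2$ over the feasible set $\{(X,Y):\mathrm{supp}(X)\subseteq I,\mathrm{supp}(Y)\subseteq J\}$ is attained. Then every point $(X,\mathbf{0})$ with $\mathrm{supp}(X)\subseteq I$, and every point $(\mathbf{0},Y)$ with $\mathrm{supp}(Y)\subseteq J$, is not in any spurious local valley of $L$. In particular, $(\mathbf{0},\mathbf{0})$ is never in any spurious local valley.
   Context: $[p]=\{1,\dots,p\}$; $\mathrm{supp}(M)=\{(i,j):M_{i,j}\ne0\}$. $L$ is regarded as a function on the feasible set identified with $\mathbb{R}^{|I|+|J|}$. A local valley of $L$ is a nonempty path-connected component of a sublevel set $\{x:L(x)\le\alpha\}$; it is spurious if it contains no global minimizer of $L$. *)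

theory Defs
  imports "HOL-Analysis.Analysis"
begin

definition supp :: "real^'b^'a \<Rightarrow> ('a \<times> 'b) set" where
  "supp M = {(i, j). M $ i $ j \<noteq> 0}"

definition frobenius_norm :: "real^'n^'m \<Rightarrow> real" where
  "frobenius_norm M = sqrt (\<Sum>i\<in>UNIV. \<Sum>j\<in>UNIV. (M $ i $ j)\<^sup>2)"

lemma frobenius_norm_eq_norm: "frobenius_norm M = norm M"
  unfolding frobenius_norm_def norm_vec_def L2_set_def
  by (simp add: sum_nonneg)

text \<open>The feasible set carries the subspace topology of the product of the two matrix
  spaces. It is the coordinate subspace of dimension \<open>card I + card J\<close>, so its paths are
  the paths of that Euclidean space.\<close>

definition feasible :: "('m::finite \<times> 'r::finite) set \<Rightarrow> ('n::finite \<times> 'r) set \<Rightarrow> ((real^'r^'m) \<times> (real^'r^'n)) set" where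
  "feasible I J = {(X, Y). supp X \<subseteq> I \<and> supp Y \<subseteq> J}"

definition loss :: "real^'n^'m \<Rightarrow> (real^'r^'m) \<times> (real^'r^'n) \<Rightarrow> real" where
  "loss A = (\<lambda>(X, Y). (frobenius_norm (A - X ** transpose Y))\<^sup>2)"

definition sublevel :: "'a set \<Rightarrow> ('a \<Rightarrow> real) \<Rightarrow> real \<Rightarrow> 'a set" where
  "sublevel F f \<alpha> = {x \<in> F. f x \<le> \<alpha>}"

text \<open>The base point \<open>x\<close> is required to lie in the sublevel set, which makes the path
  component nonempty.\<close>

definition local_valley :: "'a::topological_space set \<Rightarrow> ('a \<Rightarrow> real) \<Rightarrow> 'a set \<Rightarrow> bool" where
  "local_valley F f V \<longleftrightarrow>
     (\<exists>\<alpha>. \<exists>x\<in>sublevel F f \<alpha>. V = path_component_set (sublevel F f \<alpha>) x)"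

definition spurious_local_valley :: "'a::topological_space set \<Rightarrow> ('a \<Rightarrow> real) \<Rightarrow> 'a set \<Rightarrow> bool" where
  "spurious_local_valley F f V \<longleftrightarrow>
     local_valley F f V \<and> \<not> (\<exists>z\<in>V. is_arg_min f (\<lambda>x. x \<in> F) z)"

end

theory Submission
  imports Defs
begin

text \<open>Along the segment from \<open>(X, 0)\<close> or \<open>(0, Y)\<close> to the origin the product \<open>X Y\<^sup>T\<close> vanishes, so
  the loss is constantly \<open>\<parallel>A\<parallel>\<^sup>2\<close>. Along the segment from the origin to a global minimizer
  \<open>(X\<^sub>0, Y\<^sub>0)\<close> the residual at \<open>t\<close> is \<open>A - t\<^sup>2 X\<^sub>0 Y\<^sub>0\<^sup>T\<close>, a convex combination of \<open>A\<close> and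
  \<open>A - X\<^sub>0 Y\<^sub>0\<^sup>T\<close>, so the loss never exceeds \<open>\<parallel>A\<parallel>\<^sup>2\<close>. Hence every sublevel set containing the
  starting point also contains a path from it to the minimizer.\<close>

lemma loss_eq_norm: "loss A (X, Y) = (norm (A - X ** transpose Y))\<^sup>2"
  by (simp add: loss_def frobenius_norm_eq_norm)

lemma transpose_zero [simp]: "transpose (0 :: real^'n^'m) = 0"
  by (simp add: transpose_def vec_eq_iff)

lemma scaleR_matrix_mul_transpose_scaleR:
  fixes X :: "real^'r^'m" and Y :: "real^'r^'n"
  shows "(t *\<^sub>R X) ** transpose (t *\<^sub>R Y) = t\<^sup>2 *\<^sub>R (X ** transpose Y)"
  by (simp add: matrix_matrix_mult_def transpose_def vec_eq_iff sum_distrib_left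
      power2_eq_square ac_simps)

lemma scaleR_mem_feasible: "Z \<in> feasible I J \<Longrightarrow> t *\<^sub>R Z \<in> feasible I J"
  by (auto simp: feasible_def supp_def)

lemma path_component_zero_if_ray:
  fixes x :: "'a::real_normed_vector"
  assumes "\<And>t. 0 \<le> t \<Longrightarrow> t \<le> 1 \<Longrightarrow> t *\<^sub>R x \<in> S"
  shows "path_component S 0 x"
proof -
  have "path_image (linepath 0 x) \<subseteq> S"
    using assms by (auto simp: closed_segment_def)
  then show ?thesis
    unfolding path_component_def by (intro exI[of _ "linepath 0 x"]) auto
qed

text \<open>The loss is not convex in the pair, but on a ray through the origin both factors scale
  by \<open>t\<close>, so it is a convex function of \<open>t\<^sup>2\<close>.\<close>

lemma loss_scaleR_le:
  assumes le: "loss A Z \<le> loss A 0" and t: "0 \<le> t" "t \<le> 1"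
  shows "loss A (t *\<^sub>R Z) \<le> loss A 0"
proof -
  obtain X Y where Z: "Z = (X, Y)" by (cases Z)
  define M where "M = X ** transpose Y"
  have t2: "0 \<le> t\<^sup>2" "t\<^sup>2 \<le> 1" using t by (auto simp: power_le_one)
  have nle: "norm (A - M) \<le> norm A"
    using le by (simp add: Z loss_eq_norm M_def zero_prod_def power2_le_iff_abs_le)
  have "A - t\<^sup>2 *\<^sub>R M = (1 - t\<^sup>2) *\<^sub>R A + t\<^sup>2 *\<^sub>R (A - M)"
    by (simp add: algebra_simps)
  then have "norm (A - t\<^sup>2 *\<^sub>R M) \<le> (1 - t\<^sup>2) * norm A + t\<^sup>2 * norm (A - M)"
    using norm_triangle_ineq[of "(1 - t\<^sup>2) *\<^sub>R A" "t\<^sup>2 *\<^sub>R (A - M)"] t2 by simp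
  also have "\<dots> \<le> (1 - t\<^sup>2) * norm A + t\<^sup>2 * norm A"
    using nle t2 by (intro add_left_mono mult_left_mono) auto
  finally have "norm (A - t\<^sup>2 *\<^sub>R M) \<le> norm A" by (simp add: algebra_simps)
  then show ?thesis
    by (simp add: Z loss_eq_norm M_def zero_prod_def scaleR_matrix_mul_transpose_scaleR
        power_mono)
qed

lemma path_component_sublevel_loss:
  assumes Z: "Z \<in> feasible I J" "loss A Z \<le> loss A 0" and \<alpha>: "loss A 0 \<le> \<alpha>"
  shows "path_component (sublevel (feasible I J) (loss A) \<alpha>) 0 Z"
proof (rule path_component_zero_if_ray)
  fix t :: real assume "0 \<le> t" "t \<le> 1"
  then show "t *\<^sub>R Z \<in> sublevel (feasible I J) (loss A) \<alpha>"
    using order_trans[OF loss_scaleR_le[OF Z(2)] \<alpha>] scaleR_mem_feasible[OF Z(1)]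
    by (simp add: sublevel_def)
qed

text \<open>Assuming only the value of the loss at \<open>P\<close> covers all points with a zero
  factor at once.\<close>

lemma not_in_spurious_local_valley:
  assumes Z: "is_arg_min (loss A) (\<lambda>W. W \<in> feasible I J) Z"
    and P: "loss A P = loss A 0"
    and V: "spurious_local_valley (feasible I J) (loss A) V"
  shows "P \<notin> V"
proof
  assume "P \<in> V"
  obtain \<alpha> W where W: "V = path_component_set (sublevel (feasible I J) (loss A) \<alpha>) W"
    using V by (auto simp: spurious_local_valley_def local_valley_def)
  have WP: "path_component (sublevel (feasible I J) (loss A) \<alpha>) W P"
    using \<open>P \<in> V\<close> by (simp add: W)
  then have P': "P \<in> feasible I J" "loss A P \<le> \<alpha>"
    by (auto dest: path_component_mem simp: sublevel_def)
  have Z': "Z \<in> feasible I J" "loss A Z \<le> loss A P"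
    using Z P'(1) unfolding is_arg_min_def not_less[symmetric] by blast+
  \<comment> \<open>The ray lemma applies to \<open>P\<close> with equality of losses;
    \<open>P\<close> lying in the sublevel set gives \<open>loss A 0 \<le> \<alpha>\<close>.\<close>
  have "path_component (sublevel (feasible I J) (loss A) \<alpha>) 0 P"
    using P P' by (intro path_component_sublevel_loss) auto
  moreover have "path_component (sublevel (feasible I J) (loss A) \<alpha>) 0 Z"
    using P P' Z' by (intro path_component_sublevel_loss) auto
  \<comment> \<open>The base point \<open>W\<close> of the valley is arbitrary, so the path runs
    from \<open>W\<close> to \<open>P\<close>, then to the origin, then to \<open>Z\<close>.\<close>
  ultimately have "path_component (sublevel (feasible I J) (loss A) \<alpha>) W Z"
    using WP path_component_sym path_component_trans by blast
  then have "Z \<in> V" by (simp add: W)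
  with Z V show False by (auto simp: spurious_local_valley_def)
qed

theorem theorem4p24:
  fixes A :: "real^'n^'m"
    and I :: "('m::finite \<times> 'r::finite) set"
    and J :: "('n::finite \<times> 'r) set"
  assumes attained: "\<exists>Z\<in>feasible I J. loss A Z = (INF W\<in>feasible I J. loss A W)"
  shows "(\<forall>X. supp X \<subseteq> I \<longrightarrow>
            \<not> (\<exists>V. spurious_local_valley (feasible I J) (loss A) V \<and> (X, 0) \<in> V))
       \<and> (\<forall>Y. supp Y \<subseteq> J \<longrightarrow>
            \<not> (\<exists>V. spurious_local_valley (feasible I J) (loss A) V \<and> (0, Y) \<in> V))
       \<and> \<not> (\<exists>V. spurious_local_valley (feasible I J) (loss A) V \<and> (0, 0) \<in> V)"
proof -
  obtain Z where Z: "Z \<in> feasible I J" "loss A Z = (INF W\<in>feasible I J. loss A W)"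
    using attained by blast
  \<comment> \<open>A real \<open>INF\<close> is a lower bound only for a set bounded below; here
    squares are at least 0.\<close>
  have "bdd_below (loss A ` feasible I J)"
    by (rule bdd_belowI[of _ 0]) (auto simp: loss_def)
  then have "is_arg_min (loss A) (\<lambda>W. W \<in> feasible I J) Z"
    using Z by (auto simp: is_arg_min_def not_less intro: cINF_lower)
  note valley = not_in_spurious_local_valley[OF this]
  \<comment> \<open>The \<open>0\<close> on the right is the zero pair; a zero factor kills the
    product.\<close>
  have "loss A (X, 0) = loss A 0" "loss A (0, Y) = loss A 0"
    for X :: "real^'r^'m" and Y :: "real^'r^'n"
    by (simp_all add: loss_eq_norm zero_prod_def)
  with valley show ?thesis by blast
qed

end
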